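(* As $n\to\infty$ through the natural numbers, $n!$ admits the asymptotic expansion $$n!\asymp\sqrt{2\pi n}\,e^{-n}n^n\Big(\sum_{k\ge 0}\frac{a_k}{n^k}\Big),$$ whose coefficients are given, for every integer $k\ge 0$, by $$a_k=\frac{1}{2^k\,k!}\,\partial^{2k}\big(G^{-\frac{2k+1}{2}}\big)(0),\qquad\text{where}\qquad G(x)=2\,\frac{e^x-1-x}{x^2}=2\sum_{j\ge 0}\frac{x^j}{(j+2)!}.$$
   Context: $\partial^k f$ denotes the $k$-th derivative of a function $f$ with respect to its variable. The function $G$ is defined at $x=0$ by its power series, so $G(0)=1$. The asymptotic expansion is understood in the following sense: for any given integer $N\ge 0$, $$n!=\sqrt{2\pi n}\,e^{-n}n^n\Big(\sum_{k=0}^{N}\frac{a_k}{n^k}+R_{N+1}\Big),\qquad R_{N+1}=R_{N+1}(n)=O\Big(\frac{1}{n^{N+1}}\Big)\ \text{ as } n\to\infty.$$ *)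

theory Defs
  imports "HOL-Analysis.Analysis" "HOL-Library.Landau_Symbols"
begin

definition G :: "real \<Rightarrow> real" where
  "G x = (if x = 0 then 1 else 2 * ((exp x - 1 - x) / x\<^sup>2))"

lemma G_sums: "(\<lambda>j. 2 * (x ^ j / fact (j + 2))) sums G x"
proof (cases "x = 0")
  case True
  have "(\<lambda>j. 2 * ((0::real) ^ j / fact (j + 2))) sums (2 * (0 ^ 0 / fact (0 + 2)))"
    by (rule sums_single[of 0 "\<lambda>j. 2 * ((0::real) ^ j / fact (j + 2))", THEN back_subst[of "\<lambda>f. f sums _"]]) auto
  then show ?thesis using True by (simp add: G_def fact_numeral)
next
  case False
  have "(\<lambda>j. x ^ j / fact j) sums exp x"
    using exp_converges[of x] by (simp add: field_simps)
  then have "(\<lambda>j. x ^ (j + 2) / fact (j + 2)) sums (exp x - (\<Sum>j<2. x ^ j / fact j))"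
    by (rule sums_split_initial_segment)
  then have "(\<lambda>j. 2 / x\<^sup>2 * (x ^ (j + 2) / fact (j + 2))) sums (2 / x\<^sup>2 * (exp x - 1 - x))"
    by (intro sums_mult) (simp add: numeral_2_eq_2 algebra_simps)
  moreover have "2 / x\<^sup>2 * (x ^ (j + 2) / fact (j + 2)) = 2 * (x ^ j / fact (j + 2))" for j
    using False by (simp add: power_add power2_eq_square del: fact_Suc)
  ultimately show ?thesis using False by (simp add: G_def)
qed

lemma G_eq_suminf: "G x = 2 * (\<Sum>j. x ^ j / fact (j + 2))"
proof -
  have "(\<lambda>j. x ^ j / fact (j + 2)) sums (G x / 2)"
    using sums_divide[OF G_sums[of x], of 2] by simp
  then show ?thesis by (simp add: sums_iff)
qed

text \<open>
  The function \<open>G\<close> is positive and smooth on the whole real line, so the real power and the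
  iterated derivative below are the ordinary ones.
\<close>

definition stirling_coeff :: "nat \<Rightarrow> real" where
  "stirling_coeff k =
     1 / (2 ^ k * fact k) * (deriv ^^ (2 * k)) (\<lambda>x. G x powr (- (2 * real k + 1) / 2)) 0"

end

theory Submission
  imports Defs "HOL-Probability.Distributions"
begin

text \<open>
  Substituting \<open>t = n * exp (v / sqrt n)\<close> in the integral of \<open>t ^ (n - 1) * exp (- t)\<close> over
  \<open>t > 0\<close> turns \<open>n! = n * (n - 1)!\<close> into
  \<open>n! = sqrt n * exp (- n) * n ^ n * I n\<close>, where \<open>I n\<close> is the integral of
  \<open>exp (- v\<^sup>2 / 2 * G (v / sqrt n))\<close> over the real line (\<open>fact_eq_integral_exp_G\<close>).
  With \<open>\<epsilon> = 1 / sqrt n\<close>, expand the integrand by Taylor's formula in \<open>x = \<epsilon> * v\<close>, with a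
  remainder of order \<open>M = 2 * (N + 1)\<close>, and integrate term by term.

  The integrals of the Taylor terms are found without inverting a power series. The \<open>m\<close>-th
  derivative of a composition with \<open>G\<close> has the form \<open>\<Sum>j\<le>m. c m j x * F\<^sub>j (G x)\<close>, with
  coefficients \<open>c m j\<close> that depend on \<open>G\<close> alone and \<open>F\<^sub>j = (-1) ^ j\<close> times the \<open>j\<close>-th derivative
  of the outer function. For \<open>exp (- s * G x)\<close> one has \<open>F\<^sub>j (G x) = s ^ j * exp (- s * G x)\<close>, and for
  \<open>G x powr (- a)\<close> one has \<open>F\<^sub>j (G x) = pochhammer a j * G x powr (- a - j)\<close>. Gaussian moments link the
  two: for \<open>s = v\<^sup>2 / 2\<close> and \<open>a = k + 1 / 2\<close>, integrating \<open>v ^ (2 * k) * s ^ j * exp (- s)\<close> over \<open>v\<close>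
  yields \<open>pochhammer a j\<close> times a factor independent of \<open>j\<close> (\<open>fact_double_pochhammer\<close>). Hence the
  term of order \<open>2 * k\<close> integrates to \<open>sqrt (2 * pi) * stirling_coeff k / n ^ k\<close>, while those of odd
  order vanish (\<open>has_bochner_integral_taylor_sum\<close>).

  The remainder is at most \<open>\<epsilon> ^ M * W v = W v / n ^ (N + 1)\<close> with an integrable \<open>W\<close> that does not depend on
  \<open>\<epsilon>\<close> (\<open>taylor_remainder_bound\<close>). Where \<open>\<bar>\<epsilon> * v\<bar> \<le> 1\<close>, the derivatives are controlled by
  \<open>G \<ge> 1 / 2\<close> on \<open>[-1, 1]\<close>; elsewhere \<open>1 \<le> \<bar>\<epsilon> * v\<bar> ^ M\<close>, so that it suffices to bound the integrand and each
  Taylor term by a fixed integrable function, which uses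
  \<open>x\<^sup>2 / 2 * G x \<ge> \<bar>x\<bar> / 4\<close> for \<open>\<bar>x\<bar> \<ge> 1\<close>.
\<close>

section \<open>The derivatives of \<open>G\<close>\<close>

text \<open>The \<open>k\<close>-th derivative of \<open>G\<close>, as the \<open>k\<close> times differentiated power series.\<close>

definition G_deriv :: "nat \<Rightarrow> real \<Rightarrow> real" where
  "G_deriv k x = (\<Sum>j. (diffs ^^ k) (\<lambda>j. 2 / fact (j + 2)) j * x ^ j)"

lemma G_deriv_0: "G_deriv 0 = G"
  using G_sums by (auto simp: G_deriv_def fun_eq_iff sums_iff)

lemma summable_G_deriv: "summable (\<lambda>j. (diffs ^^ k) (\<lambda>j. 2 / fact (j + 2)) j * x ^ j)"
  for x :: real
proof (induction k arbitrary: x)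
  case 0
  then show ?case using sums_summable[OF G_sums[of x]] by simp
next
  case (Suc k)
  then show ?case by (auto intro: termdiff_converges_all)
qed

lemma has_derivative_G_deriv: "(G_deriv k has_real_derivative G_deriv (Suc k) x) (at x)"
  using termdiffs_strong_converges_everywhere[OF summable_G_deriv[of k]]
  unfolding G_deriv_def[abs_def] by simp

lemma DERIV_G: "(G has_real_derivative G_deriv 1 x) (at x)"
  using has_derivative_G_deriv[of 0] by (simp add: G_deriv_0)

lemma continuous_on_G: "continuous_on A G"
  by (meson DERIV_G DERIV_isCont continuous_at_imp_continuous_on)

text \<open>
  The algebra of functions generated by all derivatives of \<open>G\<close>. It is closed under
  differentiation, so its members can be differentiated any number of times.
\<close>

inductive_set G_algebra :: "(real \<Rightarrow> real) set" where
  const: "(\<lambda>_. c) \<in> G_algebra"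
| deriv: "G_deriv k \<in> G_algebra"
| diff: "f \<in> G_algebra \<Longrightarrow> g \<in> G_algebra \<Longrightarrow> (\<lambda>x. f x - g x) \<in> G_algebra"
| mult: "f \<in> G_algebra \<Longrightarrow> g \<in> G_algebra \<Longrightarrow> (\<lambda>x. f x * g x) \<in> G_algebra"

lemma G_algebra_add:
  assumes "f \<in> G_algebra" "g \<in> G_algebra" shows "(\<lambda>x. f x + g x) \<in> G_algebra"
  using G_algebra.diff[OF assms(1) G_algebra.diff[OF G_algebra.const[of 0] assms(2)]] by simp

lemma G_algebra_ex_derivative:
  assumes "f \<in> G_algebra"
  shows "\<exists>f'\<in>G_algebra. \<forall>x. (f has_real_derivative f' x) (at x)"
  using assms
proof induction
  case (const c)
  show ?case by (rule bexI[OF _ G_algebra.const[of 0]]) simp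
next
  case (deriv k)
  show ?case by (rule bexI[OF _ G_algebra.deriv[of "Suc k"]]) (simp add: has_derivative_G_deriv)
next
  case (diff f g)
  then obtain f' g' where "f' \<in> G_algebra" "g' \<in> G_algebra"
    "\<And>x. (f has_real_derivative f' x) (at x)" "\<And>x. (g has_real_derivative g' x) (at x)" by blast
  then show ?case
    by (intro bexI[of _ "\<lambda>x. f' x - g' x"]) (auto intro!: derivative_intros G_algebra.diff)
next
  case (mult f g)
  then obtain f' g' where *: "f' \<in> G_algebra" "g' \<in> G_algebra"
    "\<And>x. (f has_real_derivative f' x) (at x)" "\<And>x. (g has_real_derivative g' x) (at x)" by blast
  show ?case
    by (rule bexI[of _ "\<lambda>x. f' x * g x + g' x * f x"])
      (auto intro!: DERIV_mult G_algebra_add G_algebra.mult mult * )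
qed

lemma
  assumes "f \<in> G_algebra"
  shows G_algebra_deriv: "deriv f \<in> G_algebra"
    and G_algebra_DERIV: "(f has_real_derivative deriv f x) (at x)"
proof -
  obtain f' where f': "f' \<in> G_algebra" "\<And>x. (f has_real_derivative f' x) (at x)"
    using G_algebra_ex_derivative[OF assms] by blast
  then have "deriv f = f'" by (intro ext DERIV_imp_deriv)
  with f' show "deriv f \<in> G_algebra" "(f has_real_derivative deriv f x) (at x)" by auto
qed

section \<open>Higher derivatives of a composition with \<open>G\<close>\<close>

text \<open>
  The coefficients \<open>c m j\<close> in \<open>(F \<circ> G)\<^sup>(\<^sup>m\<^sup>) = (\<Sum>j\<le>m. c m j * (-1) ^ j * (F\<^sup>(\<^sup>j\<^sup>) \<circ> G))\<close>. Up to the sign,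
  these are the partial Bell polynomials in the derivatives of \<open>G\<close>.
\<close>

fun comp_coeff :: "nat \<Rightarrow> nat \<Rightarrow> real \<Rightarrow> real" where
  "comp_coeff 0 0 = (\<lambda>_. 1)"
| "comp_coeff 0 (Suc j) = (\<lambda>_. 0)"
| "comp_coeff (Suc m) 0 = deriv (comp_coeff m 0)"
| "comp_coeff (Suc m) (Suc j) =
     (\<lambda>x. deriv (comp_coeff m (Suc j)) x - G_deriv 1 x * comp_coeff m j x)"

lemma comp_coeff_in_G_algebra: "comp_coeff m j \<in> G_algebra"
  by (induction m j rule: comp_coeff.induct)
    (auto intro!: G_algebra.intros G_algebra_deriv simp del: One_nat_def)

lemmas DERIV_comp_coeff = G_algebra_DERIV[OF comp_coeff_in_G_algebra]

lemma continuous_on_comp_coeff: "continuous_on A (comp_coeff m j)"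
  by (meson DERIV_comp_coeff DERIV_isCont continuous_at_imp_continuous_on)

lemma comp_coeff_eq_0: "m < j \<Longrightarrow> comp_coeff m j = (\<lambda>_. 0)"
  by (induction m j rule: comp_coeff.induct) auto

text \<open>
  The assumption says that differentiating \<open>F j\<close> has the effect of the chain rule for
  \<open>F j = (-1) ^ j * (f\<^sup>(\<^sup>j\<^sup>) \<circ> G)\<close>, so one step of the recursion for the coefficients is one
  differentiation.
\<close>

lemma DERIV_comp_coeff_sum:
  fixes F :: "nat \<Rightarrow> real \<Rightarrow> real"
  assumes F: "\<And>j. (F j has_real_derivative - G_deriv 1 x * F (Suc j) x) (at x)"
  shows "((\<lambda>x. \<Sum>j\<le>m. comp_coeff m j x * F j x) has_real_derivative
           (\<Sum>j\<le>Suc m. comp_coeff (Suc m) j x * F j x)) (at x)"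
proof -
  let ?c = comp_coeff
  have "((\<lambda>x. \<Sum>j\<le>m. ?c m j x * F j x) has_real_derivative
      (\<Sum>j\<le>m. deriv (?c m j) x * F j x + - G_deriv 1 x * F (Suc j) x * ?c m j x)) (at x)"
    by (intro DERIV_sum DERIV_mult DERIV_comp_coeff F)
  also have "(\<Sum>j\<le>m. deriv (?c m j) x * F j x + - G_deriv 1 x * F (Suc j) x * ?c m j x) =
      (\<Sum>j\<le>m. deriv (?c m j) x * F j x) - (\<Sum>j\<le>m. G_deriv 1 x * ?c m j x * F (Suc j) x)"
    by (subst sum_subtractf[symmetric]) (simp add: algebra_simps)
  also have "(\<Sum>j\<le>m. deriv (?c m j) x * F j x) = (\<Sum>j\<le>Suc m. deriv (?c m j) x * F j x)"
    by (simp add: comp_coeff_eq_0)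
  also have "\<dots> - (\<Sum>j\<le>m. G_deriv 1 x * ?c m j x * F (Suc j) x) =
      (\<Sum>j\<le>Suc m. ?c (Suc m) j x * F j x)"
    unfolding sum.atMost_Suc_shift by (simp add: sum_subtractf algebra_simps)
  finally show ?thesis .
qed

lemma DERIV_exp_G:
  "((\<lambda>x. \<Sum>j\<le>m. comp_coeff m j x * (s ^ j * exp (- s * G x))) has_real_derivative
      (\<Sum>j\<le>Suc m. comp_coeff (Suc m) j x * (s ^ j * exp (- s * G x)))) (at x)"
  by (rule DERIV_comp_coeff_sum) (auto intro!: derivative_eq_intros DERIV_G)

section \<open>Lower bounds for \<open>G\<close>\<close>

lemma G_times_square: "x\<^sup>2 / 2 * G x = exp x - 1 - x"
  by (simp add: G_def)

lemma G_ge_half: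
  assumes "- 2 \<le> x" shows "1 / 2 \<le> G x"
proof (cases "x = 0")
  case False
  \<comment> \<open>Square the tangent line bound for \<open>exp (x / 2)\<close>, which is nonnegative from \<open>- 2\<close> on.\<close>
  have "1 + x + x\<^sup>2 / 4 = (1 + x / 2)\<^sup>2" by (simp add: power2_eq_square field_simps)
  also have "\<dots> \<le> exp (x / 2) ^ 2"
    using assms by (intro power_mono) (auto simp: exp_ge_add_one_self)
  also have "\<dots> = exp x" by (simp flip: exp_of_nat_mult)
  finally show ?thesis using False by (simp add: G_def field_simps)
qed (simp add: G_def)

lemma G_times_square_ge:
  assumes "1 \<le> \<bar>x\<bar>" shows "\<bar>x\<bar> / 4 \<le> x\<^sup>2 / 2 * G x"
proof (cases "- 2 \<le> x")
  case True
  have "\<bar>x\<bar> / 4 \<le> x\<^sup>2 / 4"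
    using assms by (metis abs_ge_zero divide_right_mono mult_right_mono mult_1 power2_abs
      power2_eq_square zero_le_numeral)
  also have "\<dots> = x\<^sup>2 / 2 * (1 / 2)" by simp
  also have "\<dots> \<le> x\<^sup>2 / 2 * G x" by (intro mult_left_mono G_ge_half True) simp
  finally show ?thesis .
next
  case False
  then show ?thesis unfolding G_times_square using exp_gt_zero[of x] by linarith
qed

lemma G_pos: "0 < G x"
proof (cases "- 2 \<le> x")
  case True
  then show ?thesis using G_ge_half[of x] by simp
next
  case False
  then have "0 < x\<^sup>2 / 2 * G x" using G_times_square_ge[of x] by linarith
  then show ?thesis by (simp add: zero_less_mult_iff)
qed

lemma higher_deriv_G_powr:
  "(deriv ^^ m) (\<lambda>x. G x powr (- a)) =
     (\<lambda>x. \<Sum>j\<le>m. comp_coeff m j x * (pochhammer a j * G x powr (- a - real j)))"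
proof (induction m)
  case (Suc m)
  have "((\<lambda>x. \<Sum>j\<le>m. comp_coeff m j x * (pochhammer a j * G x powr (- a - real j)))
      has_real_derivative
      (\<Sum>j\<le>Suc m. comp_coeff (Suc m) j x * (pochhammer a j * G x powr (- a - real j)))) (at x)" for x
  proof (rule DERIV_comp_coeff_sum)
    fix j
    have exponent: "- a - real j - 1 = - a - real (Suc j)" by simp
    have "((\<lambda>x. G x powr (- a - real j)) has_real_derivative
        (- a - real j) * G x powr (- a - real (Suc j)) * G_deriv 1 x) (at x)"
      using DERIV_fun_powr[OF DERIV_G[of x] G_pos, of "- a - real j"]
      by (simp only: of_nat_1 exponent)
    from DERIV_cmult[OF this, of "pochhammer a j"]
    show "((\<lambda>x. pochhammer a j * G x powr (- a - real j)) has_real_derivative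
        - G_deriv 1 x * (pochhammer a (Suc j) * G x powr (- a - real (Suc j)))) (at x)"
      by (simp add: pochhammer_Suc algebra_simps)
  qed
  then show ?case using Suc by (auto intro!: ext DERIV_imp_deriv)
qed simp

lemma stirling_coeff_eq:
  "stirling_coeff k =
     (\<Sum>j\<le>2 * k. comp_coeff (2 * k) j 0 * pochhammer (real k + 1 / 2) j) / (2 ^ k * fact k)"
proof -
  have "- (2 * real k + 1) / 2 = - (real k + 1 / 2)" by simp
  moreover have "G 0 = 1" by (simp add: G_def)
  ultimately show ?thesis
    unfolding stirling_coeff_def by (simp only: higher_deriv_G_powr) simp
qed

section \<open>The factorial as an integral\<close>

lemma has_bochner_integral_power_times_exp:
  "has_bochner_integral lborel (\<lambda>x::real. indicator {0..} x *\<^sub>R (x ^ k * exp (- x))) (fact k)"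
proof (rule has_bochner_integral_nn_integral)
  have "(\<integral>\<^sup>+x. ennreal (indicator {0..} x *\<^sub>R (x ^ k * exp (- x))) \<partial>lborel) =
      (\<integral>\<^sup>+x. ennreal (x ^ k * exp (- x)) * indicator {0..} x \<partial>(lborel :: real measure))"
    by (intro nn_integral_cong) (auto split: split_indicator)
  then show "(\<integral>\<^sup>+x. ennreal (indicator {0..} x *\<^sub>R (x ^ k * exp (- x))) \<partial>lborel) = ennreal (fact k)"
    using nn_intergal_power_times_exp_Ici[of k] by simp
qed (auto split: split_indicator)

lemma integrable_power_times_exp:
  assumes "0 < c"
  shows "integrable lborel (\<lambda>x::real. \<bar>x\<bar> ^ k * exp (- c * \<bar>x\<bar>))"
proof -
  have "has_bochner_integral lborel (\<lambda>x::real. indicator {0..} x *\<^sub>R (\<bar>x\<bar> ^ k * exp (- \<bar>x\<bar>))) (fact k)"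
    by (rule has_bochner_integral_cong[THEN iffD1, OF refl _ refl has_bochner_integral_power_times_exp])
      (auto split: split_indicator)
  from has_bochner_integral_even_function[OF this]
  have "integrable lborel (\<lambda>x::real. \<bar>x\<bar> ^ k * exp (- \<bar>x\<bar>))"
    by (simp add: has_bochner_integral_iff)
  from lborel_integrable_real_affine[OF this, of c 0] assms
  have "integrable lborel (\<lambda>x. c ^ k * (\<bar>x\<bar> ^ k * exp (- c * \<bar>x\<bar>)))"
    by (simp add: abs_mult power_mult_distrib mult.assoc)
  then show ?thesis using assms by simp
qed

lemma
  assumes n: "0 < n"
  shows integrable_exp_G: "integrable lborel (\<lambda>v. exp (- (v\<^sup>2 / 2) * G (v / sqrt (real n))))"
    and fact_eq_integral_exp_G: "fact n = sqrt (real n) * exp (- real n) * real n ^ n *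
      (LBINT v. exp (- (v\<^sup>2 / 2) * G (v / sqrt (real n))))"
proof -
  let ?h = "\<lambda>v. exp (- (v\<^sup>2 / 2) * G (v / sqrt (real n)))"
  let ?f = "\<lambda>t::real. t ^ (n - 1) * exp (- t)"
  let ?g = "\<lambda>v. real n * exp (v / sqrt (real n))"
  let ?g' = "\<lambda>v. sqrt (real n) * exp (v / sqrt (real n))"
  let ?C = "exp (- real n) * real n ^ n / sqrt (real n)"
  \<comment> \<open>The substitution has range \<open>{0<..}\<close>, so the origin is dropped from the domain.\<close>
  have "has_bochner_integral lborel (\<lambda>x::real. indicator {0<..} x *\<^sub>R ?f x) (fact (n - 1))"
    using AE_lborel_singleton[of "0::real"]
    by (intro has_bochner_integral_cong_AE[THEN iffD1, OF _ _ _ has_bochner_integral_power_times_exp])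
      (auto split: split_indicator elim!: eventually_mono)
  then have f: "set_integrable lborel {0<..} ?f" "set_lebesgue_integral lborel {0<..} ?f = fact (n - 1)"
    unfolding set_integrable_def set_lebesgue_integral_def by (auto simp: has_bochner_integral_iff)
  have "range ?g = {0<..}"
  proof (intro subset_antisym subsetI)
    fix t :: real assume "t \<in> {0<..}"
    then have "t = ?g (sqrt (real n) * ln (t / real n))" using n by simp
    then show "t \<in> range ?g" by blast
  qed (use n in auto)
  then have fg: "?f absolutely_integrable_on range ?g \<and> integral (range ?g) ?f = fact (n - 1)"
    using f set_borel_integral_eq_integral[OF f(1)]
    by (simp add: set_integrable_def integrable_completion)
  have inj: "inj ?g" using n by (auto simp: inj_on_def)
  have g_deriv: "(?g has_field_derivative ?g' v) (at v)" for v
    using n by (auto intro!: derivative_eq_intros simp: field_simps)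
  have "\<bar>?g' v\<bar> * ?f (?g v) = ?C * ?h v" for v
  proof -
    let ?x = "v / sqrt (real n)"
    have "- (v\<^sup>2 / 2) * G ?x = - real n * (?x\<^sup>2 / 2 * G ?x)"
      using n by (simp add: power_divide)
    also have "\<dots> = real n + real n * ?x - real n * exp ?x"
      unfolding G_times_square by (simp add: algebra_simps)
    finally have h: "?h v = exp (real n) * exp (real n * ?x) * exp (- real n * exp ?x)"
      unfolding exp_add[symmetric] by (intro arg_cong[of _ _ exp]) linarith
    have "\<bar>?g' v\<bar> * ?f (?g v) =
        sqrt (real n) * real n ^ (n - 1) * (exp ?x * exp ?x ^ (n - 1)) * exp (- real n * exp ?x)"
      using n by (simp add: power_mult_distrib abs_mult)
    also have "exp ?x * exp ?x ^ (n - 1) = exp (real n * ?x)"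
      using n by (metis exp_of_nat_mult power_Suc Suc_pred')
    also have "sqrt (real n) * real n ^ (n - 1) = real n ^ n / sqrt (real n)"
      using n by (cases n) (auto simp: real_div_sqrt simp flip: times_divide_eq_left)
    finally show ?thesis unfolding h by (simp add: exp_minus)
  qed
  then have cov: "(\<lambda>v. ?C * ?h v) absolutely_integrable_on UNIV \<and>
      integral UNIV (\<lambda>v. ?C * ?h v) = fact (n - 1)"
    using has_absolute_integral_change_of_variables_1'[of UNIV ?g ?g' ?f "fact (n - 1)"] fg inj g_deriv
    by simp
  have meas: "?h \<in> borel_measurable lborel"
    using n by (auto intro!: borel_measurable_continuous_onI continuous_intros
      continuous_on_compose2[OF continuous_on_G[of UNIV]])
  with cov have int: "integrable lborel (\<lambda>v. ?C * ?h v)"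
    unfolding set_integrable_def by (simp add: integrable_completion)
  with n show "integrable lborel ?h"
    by (subst (asm) integrable_mult_left_iff) simp
  have "fact (n - 1) = (LBINT v. ?C * ?h v)"
    using cov integral_lborel[OF int] by simp
  then have "fact (n - 1) = ?C * (LBINT v. ?h v)" by simp
  moreover have "(fact n :: real) = real n * fact (n - 1)" using n by (simp add: fact_reduce)
  ultimately have "fact n = (real n * ?C) * (LBINT v. ?h v)" by simp
  also have "real n * ?C = sqrt (real n) * exp (- real n) * real n ^ n"
    using n by (simp add: field_simps)
  finally show "fact n = sqrt (real n) * exp (- real n) * real n ^ n * (LBINT v. ?h v)" .
qed


section \<open>Gaussian moments\<close>

lemma has_bochner_integral_gauss_even:
  "has_bochner_integral lborel (\<lambda>v::real. v ^ (2 * k) * exp (- (v\<^sup>2 / 2)))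
     (sqrt (2 * pi) * (fact (2 * k) / (2 ^ k * fact k)))"
  using has_bochner_integral_mult_right[OF std_normal_moment_even[of k], of "sqrt (2 * pi)"]
  by (simp add: std_normal_density_def mult_ac)

lemma has_bochner_integral_gauss_odd:
  "has_bochner_integral lborel (\<lambda>v::real. v ^ (2 * k + 1) * exp (- (v\<^sup>2 / 2))) 0"
  using has_bochner_integral_mult_right[OF std_normal_moment_odd[of k], of "sqrt (2 * pi)"]
  by (simp add: std_normal_density_def mult_ac)

text \<open>
  The left side is, up to \<open>sqrt (2 * pi)\<close>, the integral of
  \<open>v ^ (2 * k) * (v\<^sup>2 / 2) ^ j * exp (- v\<^sup>2 / 2)\<close>. Its dependence on \<open>j\<close> is exactly the factor that
  \<open>j\<close> differentiations of \<open>y powr (- (k + 1 / 2))\<close> produce, up to the sign \<open>(-1) ^ j\<close>.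
\<close>

lemma fact_double_pochhammer:
  "fact (2 * (k + j)) / (2 ^ (k + j) * fact (k + j)) / 2 ^ j =
     fact (2 * k) / (2 ^ k * fact k) * pochhammer (real k + 1 / 2) j"
proof (induction j)
  case (Suc j)
  have "fact (2 * (k + Suc j)) / (2 ^ (k + Suc j) * fact (k + Suc j)) / 2 ^ Suc j =
      fact (2 * (k + j)) / (2 ^ (k + j) * fact (k + j)) / 2 ^ j * (real k + 1 / 2 + real j)"
    by (simp add: divide_simps) (simp add: algebra_simps)
  then show ?case unfolding Suc pochhammer_Suc by simp
qed simp

text \<open>The \<open>m\<close>-th derivative of \<open>x \<mapsto> exp (- v\<^sup>2 / 2 * G x)\<close> at \<open>0\<close>; recall \<open>G 0 = 1\<close>.\<close>

abbreviation gauss_taylor_coeff :: "nat \<Rightarrow> real \<Rightarrow> real" where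
  "gauss_taylor_coeff m v \<equiv> \<Sum>j\<le>m. comp_coeff m j 0 * ((v\<^sup>2 / 2) ^ j * exp (- (v\<^sup>2 / 2)))"

lemma has_bochner_integral_taylor_even:
  "has_bochner_integral lborel (\<lambda>v. v ^ (2 * k) * gauss_taylor_coeff (2 * k) v)
     (sqrt (2 * pi) * fact (2 * k) * stirling_coeff k)"
proof -
  have "has_bochner_integral lborel
      (\<lambda>v::real. \<Sum>j\<le>2 * k. comp_coeff (2 * k) j 0 / 2 ^ j * (v ^ (2 * (k + j)) * exp (- (v\<^sup>2 / 2))))
      (\<Sum>j\<le>2 * k. comp_coeff (2 * k) j 0 / 2 ^ j *
        (sqrt (2 * pi) * (fact (2 * (k + j)) / (2 ^ (k + j) * fact (k + j)))))"
    by (intro has_bochner_integral_sum has_bochner_integral_mult_right has_bochner_integral_gauss_even)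
  also have "(\<lambda>v::real. \<Sum>j\<le>2 * k. comp_coeff (2 * k) j 0 / 2 ^ j * (v ^ (2 * (k + j)) * exp (- (v\<^sup>2 / 2)))) =
      (\<lambda>v. v ^ (2 * k) * gauss_taylor_coeff (2 * k) v)"
    unfolding sum_distrib_left
    by (intro ext sum.cong refl) (simp add: power_divide power_add power_mult distrib_left)
  also have "(\<Sum>j\<le>2 * k. comp_coeff (2 * k) j 0 / 2 ^ j *
        (sqrt (2 * pi) * (fact (2 * (k + j)) / (2 ^ (k + j) * fact (k + j))))) =
      (\<Sum>j\<le>2 * k. comp_coeff (2 * k) j 0 * sqrt (2 * pi) *
        (fact (2 * k) / (2 ^ k * fact k) * pochhammer (real k + 1 / 2) j))"
    unfolding fact_double_pochhammer[symmetric] by (simp add: field_simps)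
  also have "\<dots> = sqrt (2 * pi) * fact (2 * k) * stirling_coeff k"
    unfolding stirling_coeff_eq by (simp add: sum_distrib_left sum_divide_distrib field_simps)
  finally show ?thesis .
qed

lemma has_bochner_integral_taylor_odd:
  "has_bochner_integral lborel (\<lambda>v. v ^ (2 * k + 1) * gauss_taylor_coeff (2 * k + 1) v) 0"
proof -
  have "has_bochner_integral lborel
      (\<lambda>v::real. \<Sum>j\<le>2 * k + 1. comp_coeff (2 * k + 1) j 0 / 2 ^ j *
        (v ^ (2 * (k + j) + 1) * exp (- (v\<^sup>2 / 2))))
      (\<Sum>j\<le>2 * k + 1. comp_coeff (2 * k + 1) j 0 / 2 ^ j * 0)"
    by (intro has_bochner_integral_sum has_bochner_integral_mult_right has_bochner_integral_gauss_odd)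
  also have "(\<lambda>v::real. \<Sum>j\<le>2 * k + 1. comp_coeff (2 * k + 1) j 0 / 2 ^ j *
        (v ^ (2 * (k + j) + 1) * exp (- (v\<^sup>2 / 2)))) =
      (\<lambda>v. v ^ (2 * k + 1) * gauss_taylor_coeff (2 * k + 1) v)"
    unfolding sum_distrib_left
    by (intro ext sum.cong refl) (simp add: power_divide power_add power_mult distrib_left)
  finally show ?thesis by simp
qed

lemma has_bochner_integral_taylor_sum:
  "has_bochner_integral lborel (\<lambda>v. \<Sum>m<2 * K. gauss_taylor_coeff m v / fact m * (\<epsilon> * v) ^ m)
     (sqrt (2 * pi) * (\<Sum>k<K. stirling_coeff k * \<epsilon> ^ (2 * k)))"
proof (induction K)
  case (Suc K)
  let ?t = "\<lambda>m v. gauss_taylor_coeff m v / fact m * (\<epsilon> * v) ^ m"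
  have t: "?t m = (\<lambda>v. \<epsilon> ^ m / fact m * (v ^ m * gauss_taylor_coeff m v))" for m
    by (simp add: power_mult_distrib mult_ac)
  have even: "has_bochner_integral lborel (?t (2 * K))
      (\<epsilon> ^ (2 * K) / fact (2 * K) * (sqrt (2 * pi) * fact (2 * K) * stirling_coeff K))"
    unfolding t by (intro has_bochner_integral_mult_right has_bochner_integral_taylor_even)
  have odd: "has_bochner_integral lborel (?t (2 * K + 1)) (\<epsilon> ^ (2 * K + 1) / fact (2 * K + 1) * 0)"
    unfolding t by (intro has_bochner_integral_mult_right has_bochner_integral_taylor_odd)
  have "(\<lambda>v. \<Sum>m<2 * Suc K. ?t m v) =
      (\<lambda>v. (\<Sum>m<2 * K. ?t m v) + ?t (2 * K) v + ?t (2 * K + 1) v)"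
  proof -
    have "2 * Suc K = Suc (Suc (2 * K))" by simp
    then show ?thesis by (simp only: sum.lessThan_Suc Suc_eq_plus1[symmetric])
  qed
  moreover have "sqrt (2 * pi) * (\<Sum>k<Suc K. stirling_coeff k * \<epsilon> ^ (2 * k)) =
      sqrt (2 * pi) * (\<Sum>k<K. stirling_coeff k * \<epsilon> ^ (2 * k)) +
      \<epsilon> ^ (2 * K) / fact (2 * K) * (sqrt (2 * pi) * fact (2 * K) * stirling_coeff K) +
      \<epsilon> ^ (2 * K + 1) / fact (2 * K + 1) * 0"
    by (simp add: algebra_simps)
  ultimately show ?case
    by (simp only:) (intro has_bochner_integral_add Suc.IH even odd)
qed (simp add: has_bochner_integral_zero)

section \<open>The remainder\<close>

lemma comp_coeff_bounded: "\<exists>b. \<forall>m j. 0 \<le> b m j \<and> (\<forall>x. \<bar>x\<bar> \<le> 1 \<longrightarrow> \<bar>comp_coeff m j x\<bar> \<le> b m j)"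
proof -
  have "\<exists>b\<ge>0. \<forall>x. \<bar>x\<bar> \<le> 1 \<longrightarrow> \<bar>comp_coeff m j x\<bar> \<le> b" for m j
  proof -
    have "compact (comp_coeff m j ` {-1..1})"
      by (intro compact_continuous_image continuous_on_comp_coeff) simp
    then obtain b where "\<And>x. x \<in> {-1..1} \<Longrightarrow> \<bar>comp_coeff m j x\<bar> \<le> b"
      using compact_imp_bounded[THEN bounded_iff[THEN iffD1]] by (metis imageI real_norm_def)
    moreover from this[of 0] have "0 \<le> b" by fastforce
    ultimately show ?thesis by (intro exI[of _ b]) (auto simp: abs_le_iff)
  qed
  then show ?thesis by metis
qed

text \<open>
  The bound is uniform in \<open>\<epsilon>\<close>: a single integrable \<open>W\<close> serves both ranges \<open>\<bar>\<epsilon> * v\<bar> \<le> 1\<close> and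
  \<open>\<bar>\<epsilon> * v\<bar> > 1\<close>.
\<close>

lemma taylor_remainder_bound:
  "\<exists>W. integrable lborel W \<and> (\<forall>\<epsilon> v. 0 < \<epsilon> \<longrightarrow> \<epsilon> \<le> 1 \<longrightarrow>
     \<bar>exp (- (v\<^sup>2 / 2) * G (\<epsilon> * v)) - (\<Sum>m<M. gauss_taylor_coeff m v / fact m * (\<epsilon> * v) ^ m)\<bar>
       \<le> \<epsilon> ^ M * W v)"
proof -
  \<comment> \<open>\<open>2 * q m v * exp (- \<bar>v\<bar> / 4)\<close> will bound the \<open>m\<close>-th derivative of
      \<open>x \<mapsto> exp (- v\<^sup>2 / 2 * G x)\<close> on \<open>[-1, 1]\<close>.\<close>
  obtain b where b0: "\<And>m j. 0 \<le> b m j" and b: "\<And>m j x. \<bar>x\<bar> \<le> 1 \<Longrightarrow> \<bar>comp_coeff m j x\<bar> \<le> b m j"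
    using comp_coeff_bounded by metis
  define q where "q m v = (\<Sum>j\<le>m. b m j * (v\<^sup>2 / 2) ^ j)" for m and v :: real
  define Q where "Q v = (\<Sum>m\<le>M. q m v)" for v
  define W where "W v = \<bar>v\<bar> ^ M * (1 + 2 * Q v) * exp (- (1 / 4) * \<bar>v\<bar>)" for v
  have q0: "0 \<le> q m v" for m v unfolding q_def by (intro sum_nonneg mult_nonneg_nonneg b0) auto
  have qQ: "q m v \<le> Q v" if "m \<le> M" for m v
    unfolding Q_def using that by (intro member_le_sum q0) auto
  have "\<bar>v\<bar> ^ (M + 2 * j) = \<bar>v\<bar> ^ M * (v\<^sup>2) ^ j" for v :: real and j
    by (simp add: power_add power_mult)
  then have "W = (\<lambda>v. \<bar>v\<bar> ^ M * exp (- (1 / 4) * \<bar>v\<bar>) +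
      (\<Sum>m\<le>M. \<Sum>j\<le>m. 2 * b m j / 2 ^ j * (\<bar>v\<bar> ^ (M + 2 * j) * exp (- (1 / 4) * \<bar>v\<bar>))))"
    by (simp add: W_def Q_def q_def fun_eq_iff ring_distribs sum_distrib_left sum_distrib_right
      power_divide mult_ac)
  moreover have "integrable lborel \<dots>"
    by (intro Bochner_Integration.integrable_add Bochner_Integration.integrable_sum
      integrable_mult_right integrable_power_times_exp) simp_all
  ultimately have "integrable lborel W" by simp
  moreover have "\<bar>exp (- (v\<^sup>2 / 2) * G (\<epsilon> * v)) -
      (\<Sum>m<M. gauss_taylor_coeff m v / fact m * (\<epsilon> * v) ^ m)\<bar> \<le> \<epsilon> ^ M * W v"
    if \<epsilon>: "0 < \<epsilon>" "\<epsilon> \<le> 1" for \<epsilon> v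
  proof -
    let ?E = "exp (- (1 / 4) * \<bar>v\<bar>)"
    let ?D = "\<lambda>m x. \<Sum>j\<le>m. comp_coeff m j x * ((v\<^sup>2 / 2) ^ j * exp (- (v\<^sup>2 / 2) * G x))"
    have D0: "?D m 0 = gauss_taylor_coeff m v" for m by (simp add: G_def)
    \<comment> \<open>The Gaussian is weakened to \<open>exp (- \<bar>v\<bar> / 4)\<close>, the decay available for \<open>\<bar>\<epsilon> * v\<bar> > 1\<close>.\<close>
    have gauss: "exp (- (v\<^sup>2 / 4)) \<le> 2 * ?E"
    proof -
      have "0 \<le> (\<bar>v\<bar> - 1 / 2)\<^sup>2" by simp
      then have "- (v\<^sup>2 / 4) \<le> 1 / 16 + - (1 / 4) * \<bar>v\<bar>"
        by (simp add: power2_eq_square algebra_simps flip: abs_mult)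
      then have "exp (- (v\<^sup>2 / 4)) \<le> exp (1 / 16) * ?E" by (simp flip: exp_add)
      also have "exp (1 / 16) \<le> (2::real)" using exp_bound[of "1 / 16"] by (simp add: power2_eq_square)
      finally show ?thesis by simp
    qed
    have D_bound: "\<bar>?D m x\<bar> \<le> 2 * q m v * ?E" if x: "\<bar>x\<bar> \<le> 1" for m x
    proof -
      have "\<bar>?D m x\<bar> \<le> (\<Sum>j\<le>m. \<bar>comp_coeff m j x * ((v\<^sup>2 / 2) ^ j * exp (- (v\<^sup>2 / 2) * G x))\<bar>)"
        by (rule sum_abs)
      also have "\<dots> = (\<Sum>j\<le>m. \<bar>comp_coeff m j x\<bar> * (v\<^sup>2 / 2) ^ j * exp (- (v\<^sup>2 / 2) * G x))"
        by (simp add: abs_mult mult.assoc)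
      also have "\<dots> \<le> (\<Sum>j\<le>m. b m j * (v\<^sup>2 / 2) ^ j * exp (- (v\<^sup>2 / 2) * G x))"
        by (intro sum_mono mult_right_mono b x) auto
      also have "\<dots> = q m v * exp (- (v\<^sup>2 / 2) * G x)" by (simp add: q_def sum_distrib_right)
      also have "\<dots> \<le> q m v * (2 * ?E)"
      proof (intro mult_left_mono q0)
        have "v\<^sup>2 / 2 * (1 / 2) \<le> v\<^sup>2 / 2 * G x" using x by (intro mult_left_mono G_ge_half) auto
        then have "exp (- (v\<^sup>2 / 2) * G x) \<le> exp (- (v\<^sup>2 / 4))" by simp
        with gauss show "exp (- (v\<^sup>2 / 2) * G x) \<le> 2 * ?E" by linarith
      qed
      finally show ?thesis by (simp add: mult_ac)
    qed
    have eps: "\<bar>\<epsilon> * v\<bar> ^ M = \<epsilon> ^ M * \<bar>v\<bar> ^ M" using \<epsilon> by (simp add: abs_mult power_mult_distrib)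
    show ?thesis
    proof (cases "\<bar>\<epsilon> * v\<bar> \<le> 1")
      case True
      obtain t where t: "\<bar>t\<bar> \<le> \<bar>\<epsilon> * v\<bar>" "exp (- (v\<^sup>2 / 2) * G (\<epsilon> * v)) =
          (\<Sum>m<M. ?D m 0 / fact m * (\<epsilon> * v) ^ m) + ?D M t / fact M * (\<epsilon> * v) ^ M"
      proof -
        have D_0: "?D 0 = (\<lambda>x. exp (- (v\<^sup>2 / 2) * G x))" by simp
        show thesis
          using Maclaurin_all_le[where diff = ?D, OF D_0, of "\<epsilon> * v" M] DERIV_exp_G[of _ "v\<^sup>2 / 2"] that
          by blast
      qed
      have "\<bar>exp (- (v\<^sup>2 / 2) * G (\<epsilon> * v)) - (\<Sum>m<M. gauss_taylor_coeff m v / fact m * (\<epsilon> * v) ^ m)\<bar>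
          = \<bar>?D M t\<bar> / fact M * \<bar>\<epsilon> * v\<bar> ^ M"
        unfolding t(2) D0 by (simp add: abs_mult power_abs)
      also have "\<dots> \<le> \<bar>?D M t\<bar> / 1 * \<bar>\<epsilon> * v\<bar> ^ M"
        by (intro mult_right_mono divide_left_mono) (auto simp: fact_ge_1)
      also have "\<dots> \<le> (2 * q M v * ?E) * \<bar>\<epsilon> * v\<bar> ^ M"
        using D_bound[of t M] t(1) True by (intro mult_right_mono) auto
      also have "\<dots> \<le> ((1 + 2 * Q v) * ?E) * \<bar>\<epsilon> * v\<bar> ^ M"
        using qQ[of M v] by (intro mult_right_mono) auto
      finally show ?thesis unfolding eps W_def by (simp only: mult_ac)
    next
      case False
      let ?x = "\<epsilon> * v"
      \<comment> \<open>Here no Taylor formula is used: every power \<open>\<bar>?x\<bar> ^ m\<close> with \<open>m \<le> M\<close> is at most \<open>\<bar>?x\<bar> ^ M\<close>.\<close>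
      have "\<bar>v\<bar> / 4 \<le> \<bar>v\<bar> / \<epsilon> / 4" using \<epsilon> by (simp add: field_simps mult_left_le_one_le)
      also have "\<dots> = (\<bar>?x\<bar> / 4) / \<epsilon>\<^sup>2" using \<epsilon> by (simp add: abs_mult power2_eq_square)
      also have "\<dots> \<le> (?x\<^sup>2 / 2 * G ?x) / \<epsilon>\<^sup>2"
        using False by (intro divide_right_mono G_times_square_ge) auto
      also have "\<dots> = v\<^sup>2 / 2 * G ?x" using \<epsilon> by (simp add: power_mult_distrib)
      finally have "exp (- (v\<^sup>2 / 2) * G ?x) \<le> ?E" by simp
      also have "\<dots> \<le> \<bar>?x\<bar> ^ M * ?E" using False by (simp add: one_le_power)
      finally have h: "exp (- (v\<^sup>2 / 2) * G ?x) \<le> \<bar>?x\<bar> ^ M * ?E" .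
      have "\<bar>\<Sum>m<M. gauss_taylor_coeff m v / fact m * ?x ^ m\<bar> \<le>
          (\<Sum>m<M. \<bar>gauss_taylor_coeff m v / fact m * ?x ^ m\<bar>)" by (rule sum_abs)
      also have "\<dots> \<le> (\<Sum>m<M. 2 * q m v * ?E * \<bar>?x\<bar> ^ M)"
      proof (intro sum_mono)
        fix m assume m: "m \<in> {..<M}"
        have "\<bar>gauss_taylor_coeff m v / fact m * ?x ^ m\<bar> = \<bar>?D m 0\<bar> / fact m * \<bar>?x\<bar> ^ m"
          unfolding D0 by (simp add: abs_mult power_abs)
        also have "\<dots> \<le> \<bar>?D m 0\<bar> / 1 * \<bar>?x\<bar> ^ m"
          by (intro mult_right_mono divide_left_mono) (auto simp: fact_ge_1)
        also have "\<dots> \<le> (2 * q m v * ?E) * \<bar>?x\<bar> ^ m"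
          using D_bound[of 0 m] by (intro mult_right_mono) auto
        also have "\<dots> \<le> (2 * q m v * ?E) * \<bar>?x\<bar> ^ M"
          using False m q0[of m v] by (intro mult_left_mono power_increasing) auto
        finally show "\<bar>gauss_taylor_coeff m v / fact m * ?x ^ m\<bar> \<le> 2 * q m v * ?E * \<bar>?x\<bar> ^ M" .
      qed
      also have "\<dots> = 2 * (\<Sum>m<M. q m v) * ?E * \<bar>?x\<bar> ^ M"
        by (simp add: sum_distrib_left sum_distrib_right)
      also have "\<dots> \<le> 2 * Q v * ?E * \<bar>?x\<bar> ^ M"
        unfolding Q_def by (intro mult_right_mono mult_left_mono sum_mono2) (auto simp: q0)
      finally have "\<bar>exp (- (v\<^sup>2 / 2) * G ?x) - (\<Sum>m<M. gauss_taylor_coeff m v / fact m * ?x ^ m)\<bar>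
          \<le> \<bar>?x\<bar> ^ M * ?E + 2 * Q v * ?E * \<bar>?x\<bar> ^ M"
        using h by (smt (verit) exp_gt_zero)
      also have "\<dots> = \<epsilon> ^ M * W v" unfolding eps W_def by (simp only: algebra_simps)
      finally show ?thesis .
    qed
  qed
  ultimately show ?thesis by blast
qed

section \<open>The asymptotic expansion\<close>

theorem theorem2p1:
  shows "\<forall>N::nat. \<exists>R::nat \<Rightarrow> real.
           (\<forall>n\<ge>1. (fact n :: real) =
              sqrt (2 * pi * real n) * exp (- real n) * real n ^ n *
                ((\<Sum>k=0..N. stirling_coeff k / real n ^ k) + R n)) \<and>
           R \<in> O(\<lambda>n. 1 / real n ^ (N + 1))"
proof
  fix N :: nat
  let ?S = "\<lambda>n. \<Sum>k=0..N. stirling_coeff k / real n ^ k"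
  let ?I = "\<lambda>n. LBINT v. exp (- (v\<^sup>2 / 2) * G (v / sqrt (real n)))"
  define R where "R n = ?I n / sqrt (2 * pi) - ?S n" for n
  obtain W where W: "integrable lborel W"
    and W_bound: "\<And>\<epsilon> v. 0 < \<epsilon> \<Longrightarrow> \<epsilon> \<le> 1 \<Longrightarrow>
     \<bar>exp (- (v\<^sup>2 / 2) * G (\<epsilon> * v)) -
       (\<Sum>m<2 * (N + 1). gauss_taylor_coeff m v / fact m * (\<epsilon> * v) ^ m)\<bar>
       \<le> \<epsilon> ^ (2 * (N + 1)) * W v"
    using taylor_remainder_bound[of "2 * (N + 1)"] by blast
  have "fact n = sqrt (2 * pi * real n) * exp (- real n) * real n ^ n * (?S n + R n)"
    if "n \<ge> 1" for n
    using fact_eq_integral_exp_G[of n] that by (simp add: R_def real_sqrt_mult)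
  moreover have "R \<in> O(\<lambda>n. 1 / real n ^ (N + 1))"
  proof (rule bigoI)
    show "\<forall>\<^sub>F n in sequentially. norm (R n) \<le>
        integral\<^sup>L lborel W / sqrt (2 * pi) * norm (1 / real n ^ (N + 1))"
      using eventually_gt_at_top[of 0]
    proof eventually_elim
      case n: (elim n)
      define \<epsilon> where "\<epsilon> = 1 / sqrt (real n)"
      have \<epsilon>: "0 < \<epsilon>" "\<epsilon> \<le> 1" using n by (auto simp: \<epsilon>_def)
      have \<epsilon>_pow: "\<epsilon> ^ (2 * k) = 1 / real n ^ k" for k
        by (simp add: \<epsilon>_def power_mult power_divide)
      let ?h = "\<lambda>v. exp (- (v\<^sup>2 / 2) * G (\<epsilon> * v))"
      let ?T = "\<lambda>v. \<Sum>m<2 * (N + 1). gauss_taylor_coeff m v / fact m * (\<epsilon> * v) ^ m"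
      have h: "integrable lborel ?h" "?I n = integral\<^sup>L lborel ?h"
        using integrable_exp_G[OF n] by (auto simp: \<epsilon>_def)
      have T: "integrable lborel ?T" "integral\<^sup>L lborel ?T = sqrt (2 * pi) * ?S n"
        using has_bochner_integral_taylor_sum[where K = "N + 1" and \<epsilon> = \<epsilon>]
        by (auto simp: has_bochner_integral_iff \<epsilon>_pow atLeast0AtMost lessThan_Suc_atMost
          simp del: sum.lessThan_Suc)
      have "R n = (?I n - sqrt (2 * pi) * ?S n) / sqrt (2 * pi)"
        by (simp add: R_def diff_divide_distrib)
      also have "?I n - sqrt (2 * pi) * ?S n = (LBINT v. ?h v - ?T v)"
        unfolding h(2) T(2)[symmetric] by (rule Bochner_Integration.integral_diff[symmetric, OF h(1) T(1)])
      finally have "\<bar>R n\<bar> = \<bar>LBINT v. ?h v - ?T v\<bar> / sqrt (2 * pi)" by simp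
      also have "\<bar>LBINT v. ?h v - ?T v\<bar> \<le> (LBINT v. \<epsilon> ^ (2 * (N + 1)) * W v)"
        using Bochner_Integration.integral_norm_bound_integral[OF Bochner_Integration.integrable_diff[OF h(1) T(1)]
          integrable_mult_right[OF W, of "\<epsilon> ^ (2 * (N + 1))"]] W_bound[OF \<epsilon>] by simp
      also have "\<dots> = integral\<^sup>L lborel W * (1 / real n ^ (N + 1))"
        unfolding \<epsilon>_pow by simp
      finally show ?case by (simp add: divide_right_mono mult_ac)
    qed
  qed
  ultimately show "\<exists>R. (\<forall>n\<ge>1. (fact n :: real) =
      sqrt (2 * pi * real n) * exp (- real n) * real n ^ n * (?S n + R n)) \<and>
      R \<in> O(\<lambda>n. 1 / real n ^ (N + 1))"
    by (intro exI[of _ R]) simp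
qed

end
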